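(* Let $N$ be a positive integer and let $a,b$ be real parameters such that no denominator appearing below or in the context vanishes. The rational functions of $q$-Hahn type $\mathcal U_m(n)=\mathcal U_m(n;a,b,N;q)$ obey the following recurrence relation for $m,n=0,1,\dots,N$: $$[n-m-a]_q\,\mathcal A_m\big(\mathcal U_{m+1}(n)-\mathcal U_m(n)\big)+[n+m-a+b-N]_q\,\mathcal C_m\big(\mathcal U_{m-1}(n)-\mathcal U_m(n)\big)=[a]_q[2m+b-N]_q\,\mathcal U_m(n),$$ where $$\mathcal A_m=q^{a+m}\frac{[-m-b-1]_q[m+b-N]_q}{[N-2m-b-1]_q},\qquad \mathcal C_m=q^a\frac{[m]_q[m-N-1]_q}{[2m+b-N-1]_q}.$$
   Context: $q$ is real, $q>0$, $q\ne1$; $[x]_q=\frac{1-q^x}{1-q}$; $(a;q)_0=1$, $(a;q)_k=\prod_{i=0}^{k-1}(1-aq^i)$. For $m=0,\dots,N$, $$\mathcal U_m(x;a,b,N;q)=q^{m(N-m-b)}\frac{(q^{-N};q)_m}{(q^{-m-b};q)_m}\sum_{k=0}^m\frac{(q^{-m};q)_k(q^{-x};q)_k(q^{b+m-N};q)_k}{(q^{-N};q)_k(q^{a-x};q)_k}\frac{q^k}{(q;q)_k}.$$ Conventions at the ends: $\mathcal U_{N+1}(n)=0$ for $n=0,\dots,N$ (because of the factor $(q^{-N};q)_{N+1}=0$), and the term with $\mathcal U_{-1}$ is absent since $\mathcal C_0=0$. The nonvanishing of denominators holds for instance if $a$ and $b$ are not integers. *)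

theory Defs
  imports Complex_Main
begin

definition qnum :: "real \<Rightarrow> real \<Rightarrow> real" where
  "qnum q x = (1 - q powr x) / (1 - q)"

definition qpoch :: "real \<Rightarrow> real \<Rightarrow> nat \<Rightarrow> real" where
  "qpoch z q k = (\<Prod>i<k. 1 - z * q ^ i)"

text \<open>
  The rational function of $q$-Hahn type of index \<open>m\<close>, evaluated at the real point \<open>x\<close>;
  it is meant for \<open>m \<le> N\<close>, but the formula also makes sense at \<open>m = N + 1\<close>, see
  \<open>qHahnU_Suc_N\<close> below.
\<close>

definition qHahnU :: "nat \<Rightarrow> real \<Rightarrow> real \<Rightarrow> real \<Rightarrow> nat \<Rightarrow> real \<Rightarrow> real" where
  "qHahnU m x a b N q =
     q powr (real m * (real N - real m - b))
     * (qpoch (q powr (- real N)) q m / qpoch (q powr (- real m - b)) q m)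
     * (\<Sum>k\<le>m. qpoch (q powr (- real m)) q k * qpoch (q powr (- x)) q k
                  * qpoch (q powr (b + real m - real N)) q k
                / (qpoch (q powr (- real N)) q k * qpoch (q powr (a - x)) q k)
              * (q ^ k / qpoch q q k))"

definition coeffA :: "nat \<Rightarrow> real \<Rightarrow> real \<Rightarrow> nat \<Rightarrow> real \<Rightarrow> real" where
  "coeffA m a b N q =
     q powr (a + real m)
     * (qnum q (- real m - b - 1) * qnum q (real m + b - real N)
        / qnum q (real N - 2 * real m - b - 1))"

definition coeffC :: "nat \<Rightarrow> real \<Rightarrow> real \<Rightarrow> nat \<Rightarrow> real \<Rightarrow> real" where
  "coeffC m a b N q =
     q powr a
     * (qnum q (real m) * qnum q (real m - real N - 1)
        / qnum q (2 * real m + b - real N - 1))"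

text \<open>
  Conventions at the ends of the recurrence: \<open>qHahnU (N + 1)\<close> vanishes because of its prefactor,
  although some denominators inside the sum are zero; and the truncated index \<open>m - 1\<close>
  at \<open>m = 0\<close> is harmless because the coefficient in front of that term vanishes.
\<close>

lemma qHahnU_Suc_N:
  assumes "q > 0"
  shows "qHahnU (Suc N) x a b N q = 0"
proof -
  have "1 - q powr (- real N) * q ^ N = 0"
    using assms by (simp add: powr_minus powr_realpow)
  then have "qpoch (q powr (- real N)) q (Suc N) = 0"
    unfolding qpoch_def by simp
  then show ?thesis unfolding qHahnU_def by simp
qed

lemma coeffC_0:
  assumes "q > 0"
  shows "coeffC 0 a b N q = 0"
  using assms by (simp add: coeffC_def qnum_def)

end

theory Submission
  imports Defs
begin

text \<open>
  Write \<open>M = q^m\<close>, \<open>D = q^(b+m-N)\<close>, \<open>l = q^(-N)\<close>, \<open>A = q^a\<close>, \<open>Y = q^(-n)\<close>.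
  After the prefactor of \<open>U_m\<close> is taken out and everything is multiplied by \<open>Y\<close>, the recurrence is
  a vanishing sum over \<open>k\<close> whose summand is the difference \<open>G_k - G_(k-1)\<close> of
  \<open>G_k = (1 - DM) (1/M)_k (D)_k (Y)_(k+1) / ((l)_k (q)_k (AY)_k)\<close>.
  The certificate is so simple because the two coefficient denominators already divide
  the \<open>k\<close>-th summands of the combinations of \<open>U_(m+1), U_m\<close> and of \<open>U_(m-1), U_m\<close>.
  The upper end contributes nothing: for \<open>m < N\<close> the sum runs to \<open>m + 1\<close> and
  \<open>(1/M)_(m+1) = 0\<close>, while for \<open>m = N\<close> it runs to \<open>N\<close> and \<open>(Y)_(N+1) = 0\<close>.
\<close>

section \<open>Shifted factorials\<close>

lemma qpoch_0: "qpoch z q 0 = 1"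
  by (simp add: qpoch_def)

lemma qpoch_Suc: "qpoch z q (Suc k) = qpoch z q k * (1 - z * q ^ k)"
  by (simp add: qpoch_def)

lemma qpoch_shift: "(1 - z) * qpoch (z * q) q k = qpoch z q (Suc k)"
  unfolding qpoch_def by (subst prod.lessThan_Suc_shift) (simp add: mult.assoc)

text \<open>The factor with index \<open>m\<close> is \<open>1 - q^m / q^m\<close>. This allows sums
  of different lengths to be extended to one range, and it removes the boundary term of the
  telescoping for \<open>m < N\<close>.\<close>

lemma qpoch_inverse_power_eq_0:
  assumes "q > 0" "m < k"
  shows "qpoch (1 / q ^ m) q k = 0"
  using assms unfolding qpoch_def by (auto intro!: bexI[of _ m])

text \<open>
  Quotients, up to the factor common to all terms with index \<open>k\<close>, of the \<open>k\<close>-th summands of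
  the two combinations by \<open>q D M - 1\<close> and \<open>1 - D M / q\<close>.
\<close>

definition raise_term :: "real \<Rightarrow> real \<Rightarrow> real \<Rightarrow> real \<Rightarrow> nat \<Rightarrow> real" where
  "raise_term q M D l k = (case k of 0 \<Rightarrow> D - 1 | Suc j \<Rightarrow>
     - ((1 - D * q ^ j) * (qpoch (1 / M) q j * qpoch D q j)
        * (1 + l / q - 1 / (M * q) - D + q ^ j * (D - M * l) / M)))"

definition lower_term :: "real \<Rightarrow> real \<Rightarrow> real \<Rightarrow> real \<Rightarrow> nat \<Rightarrow> real" where
  "lower_term q M D l k = (case k of 0 \<Rightarrow> M - 1 | Suc j \<Rightarrow>
     (1 - q ^ j / M) * (qpoch (1 / M) q j * qpoch D q j)
       * (M + M * l / q - 1 - D * M / q + q ^ j * (D - M * l)))"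

section \<open>Contiguous combinations, summand by summand\<close>

text \<open>Passing from \<open>m\<close> to \<open>m + 1\<close> replaces \<open>M\<close>,
  \<open>D\<close> by \<open>M * q\<close>, \<open>D * q\<close>; the two weights come from the
  ratio of the prefactors. With \<open>k = j + 1\<close>, both products contain
  \<open>(1/M)_j (D)_(j+1)\<close>, and what remains is linear in \<open>q^j\<close> and divisible
  by \<open>1 - q * D * M\<close>, the factor that cancels the denominator of
  \<open>coeffA\<close>.\<close>

lemma raise_combination:
  fixes q M D l :: real
  assumes "q \<noteq> 0" "M \<noteq> 0"
  shows "(1 - M * l) * ((1 - D) * (qpoch (1 / (M * q)) q k * qpoch (D * q) q k))
     - (q * (D * M) - M * l) * (1 - D) * (qpoch (1 / M) q k * qpoch D q k)
     = (q * (D * M) - 1) * raise_term q M D l k"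
proof (cases k)
  case 0
  then show ?thesis by (simp add: raise_term_def qpoch_0 algebra_simps)
next
  case (Suc j)
  \<comment> \<open>Naming the inverses turns the claim into a polynomial identity modulo
    \<open>M * u = 1\<close> and \<open>q * v = 1\<close>.\<close>
  define u v p r where "u = 1 / M" and "v = 1 / q" and "p = qpoch u q j" and "r = qpoch D q j"
  have uv: "M * u = 1" "q * v = 1" using assms by (simp_all add: u_def v_def)
  have "(1 - 1 / (M * q)) * qpoch (1 / (M * q) * q) q j = qpoch (1 / (M * q)) q k"
    unfolding Suc by (rule qpoch_shift)
  then have 1: "qpoch (1 / (M * q)) q k = (1 - u * v) * p"
    using assms by (simp add: u_def v_def p_def)
  have 2: "(1 - D) * qpoch (D * q) q k = r * (1 - D * q ^ j) * (1 - D * (q * q ^ j))"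
    unfolding qpoch_shift by (simp add: Suc qpoch_Suc r_def)
  have 3: "qpoch (1 / M) q k = p * (1 - u * q ^ j)" "qpoch D q k = r * (1 - D * q ^ j)"
    by (simp_all add: Suc qpoch_Suc p_def r_def u_def)
  have 4: "raise_term q M D l k = - ((1 - D * q ^ j) * (p * r)
        * (1 + l * v - u * v - D + q ^ j * (D - M * l) * u))"
    by (simp add: raise_term_def Suc p_def r_def u_def v_def)
  have key: "(1 - M * l) * (1 - u * v) * (1 - D * (q * x)) - (q * (D * M) - M * l) * (1 - D) * (1 - u * x)
     = (1 - q * (D * M)) * (1 + l * v - u * v - D + x * (D - M * l) * u)" for x
    using uv by algebra
  have "(1 - M * l) * ((1 - D) * (qpoch (1 / (M * q)) q k * qpoch (D * q) q k))
     - (q * (D * M) - M * l) * (1 - D) * (qpoch (1 / M) q k * qpoch D q k)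
     = (1 - M * l) * (qpoch (1 / (M * q)) q k * ((1 - D) * qpoch (D * q) q k))
     - (q * (D * M) - M * l) * (1 - D) * (qpoch (1 / M) q k * qpoch D q k)"
    by (simp only: mult_ac)
  also have "\<dots> = p * r * (1 - D * q ^ j) * ((1 - M * l) * (1 - u * v) * (1 - D * (q * q ^ j))
      - (q * (D * M) - M * l) * (1 - D) * (1 - u * q ^ j))"
    unfolding 1 2 3 by algebra
  also have "\<dots> = (q * (D * M) - 1) * raise_term q M D l k"
    unfolding key 4 by algebra
  finally show ?thesis .
qed

text \<open>The mirror image, with \<open>M / q\<close> and \<open>D / q\<close> for
  \<open>m - 1\<close>. The factor \<open>1 - M\<close>, supplied by \<open>[m]_q\<close> in
  \<open>coeffC\<close>, completes \<open>(q/M)_k\<close> to \<open>- M (1/M)_(k+1)\<close>, so that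
  \<open>(1/M)_(j+1) (D)_j\<close> can be taken out for \<open>k = j + 1\<close>. The factor
  \<open>1 - D * M / q\<close> cancels the denominator of \<open>coeffC\<close>.\<close>

lemma lower_combination:
  fixes q M D l :: real
  assumes "q \<noteq> 0" "M \<noteq> 0"
  shows "(1 - M) * ((D * M - M * l) / q * (qpoch (q / M) q k * qpoch (D / q) q k)
       - (1 - M * l / q) * (qpoch (1 / M) q k * qpoch D q k))
     = (1 - D * M / q) * lower_term q M D l k"
proof (cases k)
  case 0
  show ?thesis
    using assms by (simp add: 0 lower_term_def qpoch_0 field_simps)
next
  case (Suc j)
  define u v p r where "u = 1 / M" and "v = 1 / q" and "p = qpoch u q j" and "r = qpoch D q j"
  have uv: "M * u = 1" "q * v = 1" using assms by (simp_all add: u_def v_def)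
  have "(1 - D / q) * qpoch (D / q * q) q j = qpoch (D / q) q k"
    unfolding Suc by (rule qpoch_shift)
  then have 1: "qpoch (D / q) q k = (1 - D * v) * r"
    using assms by (simp add: v_def r_def)
  have "(1 - u) * qpoch (u * q) q k = p * (1 - u * q ^ j) * (1 - u * (q * q ^ j))"
    unfolding qpoch_shift by (simp add: Suc qpoch_Suc p_def)
  moreover have "1 - M = - M * (1 - u)" "q / M = u * q"
    using uv by (simp_all add: u_def right_diff_distrib)
  ultimately have 2: "(1 - M) * qpoch (q / M) q k = - M * (p * (1 - u * q ^ j) * (1 - u * (q * q ^ j)))"
    by (simp only: mult.assoc)
  have 3: "qpoch (1 / M) q k = p * (1 - u * q ^ j)" "qpoch D q k = r * (1 - D * q ^ j)"
    by (simp_all add: Suc qpoch_Suc p_def r_def u_def)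
  have 4: "lower_term q M D l k = (1 - u * q ^ j) * (p * r)
        * (M + M * l * v - 1 - D * M * v + q ^ j * (D - M * l))"
    by (simp add: lower_term_def Suc p_def r_def u_def v_def)
  have key: "- M * (1 - u * (q * x)) * ((D * M - M * l) * v * (1 - D * v))
      - (1 - M) * (1 - M * l * v) * (1 - D * x)
     = (1 - D * M * v) * (M + M * l * v - 1 - D * M * v + x * (D - M * l))" for x
    using uv by algebra
  have "(1 - M) * ((D * M - M * l) / q * (qpoch (q / M) q k * qpoch (D / q) q k)
       - (1 - M * l / q) * (qpoch (1 / M) q k * qpoch D q k))
     = (D * M - M * l) * v * (((1 - M) * qpoch (q / M) q k) * qpoch (D / q) q k)
       - (1 - M) * (1 - M * l * v) * (qpoch (1 / M) q k * qpoch D q k)"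
  proof -
    have v: "(D * M - M * l) / q = (D * M - M * l) * v" "M * l / q = M * l * v"
      by (simp_all add: v_def)
    show ?thesis unfolding v by algebra
  qed
  also have "\<dots> = p * r * (1 - u * q ^ j) * (- M * (1 - u * (q * q ^ j)) * ((D * M - M * l) * v * (1 - D * v))
      - (1 - M) * (1 - M * l * v) * (1 - D * q ^ j))"
    unfolding 1 2 3 by algebra
  also have "\<dots> = (1 - D * M / q) * lower_term q M D l k"
    unfolding key 4 by (simp add: v_def)
  finally show ?thesis .
qed

section \<open>Telescoping\<close>

lemma telescoped_sum:
  fixes q A M D l Y :: real
  assumes "q \<noteq> 0" "M \<noteq> 0"
    and nz: "qpoch l q R \<noteq> 0" "qpoch (A * Y) q R \<noteq> 0" "qpoch q q R \<noteq> 0"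
  shows "(\<Sum>k\<le>R. q ^ k * qpoch Y q k / (qpoch l q k * qpoch q q k * qpoch (A * Y) q k)
      * ((A * M * Y - 1) * raise_term q M D l k + (A * Y - D) * lower_term q M D l k
         - Y * (1 - A) * (1 - D * M) * (qpoch (1 / M) q k * qpoch D q k)))
    = (1 - D * M) * (qpoch (1 / M) q R * qpoch D q R) * qpoch Y q (Suc R)
        / (qpoch l q R * qpoch q q R * qpoch (A * Y) q R)"
  using nz
proof (induction R)
  case 0
  show ?case
    by (simp add: qpoch_0 qpoch_Suc raise_term_def lower_term_def algebra_simps)
next
  case (Suc j)
  define u v p r where "u = 1 / M" and "v = 1 / q" and "p = qpoch u q j" and "r = qpoch D q j"
  define x e where "x = q ^ j" and "e = qpoch Y q (Suc j)"
  define f g h where "f = qpoch l q j" and "g = qpoch q q j" and "h = qpoch (A * Y) q j"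
  have uv: "M * u = 1" "q * v = 1" using assms by (simp_all add: u_def v_def)
  have nz: "f \<noteq> 0" "g \<noteq> 0" "h \<noteq> 0" "1 - l * x \<noteq> 0" "1 - q * x \<noteq> 0" "1 - A * Y * x \<noteq> 0"
    using Suc.prems by (auto simp: qpoch_Suc f_def g_def h_def x_def)
  \<comment> \<open>With \<open>x = q^j\<close>, this says that \<open>G_j\<close> plus the new
    summand is \<open>G_(j+1)\<close>, after clearing denominators and dropping the common factor
    \<open>p * r * e\<close>.\<close>
  have key: "(1 - D * M) * (1 - l * x) * (1 - q * x) * (1 - A * Y * x)
      + q * x * ((A * M * Y - 1) * (- ((1 - D * x) * (1 + l * v - u * v - D + x * (D - M * l) * u)))
        + (A * Y - D) * ((1 - u * x) * (M + M * l * v - 1 - D * M * v + x * (D - M * l)))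
         - Y * (1 - A) * (1 - D * M) * ((1 - u * x) * (1 - D * x)))
     = (1 - D * M) * ((1 - u * x) * (1 - D * x)) * (1 - Y * (q * x))"
    using uv by algebra
  have den: "P / (f * g * h) + q * x * e / (f * (1 - l * x) * (g * (1 - q * x)) * (h * (1 - A * Y * x))) * T
      = (P * (1 - l * x) * (1 - q * x) * (1 - A * Y * x) + q * x * e * T)
        / (f * (1 - l * x) * (g * (1 - q * x)) * (h * (1 - A * Y * x)))" for P T
    using nz by (simp add: divide_simps)
  have prev: "(\<Sum>k\<le>j. q ^ k * qpoch Y q k / (qpoch l q k * qpoch q q k * qpoch (A * Y) q k)
      * ((A * M * Y - 1) * raise_term q M D l k + (A * Y - D) * lower_term q M D l k
         - Y * (1 - A) * (1 - D * M) * (qpoch (1 / M) q k * qpoch D q k)))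
      = (1 - D * M) * (p * r) * e / (f * g * h)"
    using Suc.IH nz by (simp add: f_def g_def h_def p_def r_def e_def u_def)
  have terms: "raise_term q M D l (Suc j) = - ((1 - D * x) * (p * r)
        * (1 + l * v - u * v - D + x * (D - M * l) * u))"
    "lower_term q M D l (Suc j) = (1 - u * x) * (p * r)
        * (M + M * l * v - 1 - D * M * v + x * (D - M * l))"
    by (simp_all add: raise_term_def lower_term_def p_def r_def u_def v_def x_def)
  have qp: "qpoch (1 / M) q (Suc j) = p * (1 - u * x)" "qpoch D q (Suc j) = r * (1 - D * x)"
    "qpoch l q (Suc j) = f * (1 - l * x)" "qpoch q q (Suc j) = g * (1 - q * x)"
    "qpoch (A * Y) q (Suc j) = h * (1 - A * Y * x)" "q ^ Suc j = q * x"
    "qpoch Y q (Suc (Suc j)) = e * (1 - Y * (q * x))"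
    by (simp_all add: qpoch_Suc p_def r_def u_def x_def f_def g_def h_def e_def)
  show ?case
    unfolding sum.atMost_Suc prev terms qp e_def[symmetric] den
    by (rule arg_cong[where f = "\<lambda>t. t / _"]) (use key in algebra)
qed

section \<open>From identities between sums to the recurrence\<close>

text \<open>Here \<open>S\<close>, \<open>Sp\<close>, \<open>Sm\<close> stand for the sums of index
  \<open>m\<close>, \<open>m + 1\<close>, \<open>m - 1\<close>, and \<open>c\<close> for the
  prefactor of \<open>U\<close>. The hypotheses on \<open>Up\<close> and \<open>Um\<close> keep
  factors that the coefficients of the recurrence supply anyway; in this form they remain valid at
  \<open>m = N\<close> and \<open>m = 0\<close>, where dividing by these factors may be
  impossible.\<close>

lemma recurrence_from_sums:
  fixes q A B M D l Y c S Sp Sm SA SC U Up Um :: real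
  assumes nz: "q \<noteq> 0" "A \<noteq> 0" "B \<noteq> 0" "M \<noteq> 0" "l \<noteq> 0" "Y \<noteq> 0"
    and D: "D = B * M * l"
    and denA: "1 - 1 / (q * (D * M)) \<noteq> 0" and denC: "1 - D * M / q \<noteq> 0"
    and SA: "(1 - M * l) * ((1 - D) * Sp) - (q * (D * M) - M * l) * (1 - D) * S = (q * (D * M) - 1) * SA"
    and SC: "(1 - M) * ((D * M - M * l) / q * Sm - (1 - M * l / q) * S) = (1 - D * M / q) * SC"
    and tel: "(A * M * Y - 1) * SA + (A * Y - D) * SC - Y * (1 - A) * (1 - D * M) * S = 0"
    and U: "U = c * S"
    and Up: "(1 - 1 / (M * q * B)) * Up = c / (q * (D * M)) * (1 - M * l) * Sp"
    and Um: "(1 - M) * ((1 - M * l / q) * Um) = (1 - M) * (c * (D * M / q) * (1 - 1 / (M * B)) * Sm)"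
  shows "(1 - 1 / (Y * M * A)) * (A * M * ((1 - 1 / (M * q * B)) * (1 - D) / (1 - 1 / (q * (D * M))))) * (Up - U)
     + (1 - D / (A * Y)) * (A * ((1 - M) * (1 - M * l / q) / (1 - D * M / q))) * (Um - U)
     = (1 - A) * (1 - D * M) * U"
proof -
  have D0: "D \<noteq> 0" using D nz by simp
  have quotient: "x / e * y = z" if "x * y = e * z" "e \<noteq> 0" for x y z e :: real
    using that by (simp add: nonzero_divide_eq_eq mult_ac)
  have "q * (D * M) * ((1 - 1 / (M * q * B)) * (1 - D) * (Up - U))
      = (1 - D) * (q * (D * M) * ((1 - 1 / (M * q * B)) * Up) - q * (D * M) * (1 - 1 / (M * q * B)) * U)"
    by algebra
  also have "q * (D * M) * ((1 - 1 / (M * q * B)) * Up) = c * (1 - M * l) * Sp"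
    unfolding Up using nz D0 by simp
  also have "q * (D * M) * (1 - 1 / (M * q * B)) = q * (D * M) - M * l"
    using nz by (simp add: right_diff_distrib) (simp add: D)
  also have "(1 - D) * (c * (1 - M * l) * Sp - (q * (D * M) - M * l) * U)
      = c * ((1 - M * l) * ((1 - D) * Sp) - (q * (D * M) - M * l) * (1 - D) * S)"
    unfolding U by algebra
  also have "\<dots> = c * ((q * (D * M) - 1) * SA)"
    unfolding SA ..
  also have "\<dots> = q * (D * M) * ((1 - 1 / (q * (D * M))) * (c * SA))"
    using nz D0 by (simp add: field_simps)
  finally have "(1 - 1 / (M * q * B)) * (1 - D) * (Up - U) = (1 - 1 / (q * (D * M))) * (c * SA)"
    using nz D0 by simp
  then have 1: "(1 - 1 / (M * q * B)) * (1 - D) / (1 - 1 / (q * (D * M))) * (Up - U) = c * SA"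
    using denA by (rule quotient)
  have l: "D * M / q * (1 - 1 / (M * B)) = (D * M - M * l) / q"
    using nz by (simp add: D field_simps)
  have "(1 - M) * (1 - M * l / q) * (Um - U)
      = (1 - M) * ((1 - M * l / q) * Um) - (1 - M) * (1 - M * l / q) * U"
    by algebra
  also have "\<dots> = c * ((1 - M) * (D * M / q * (1 - 1 / (M * B)) * Sm - (1 - M * l / q) * S))"
    unfolding Um U by algebra
  also have "\<dots> = (1 - D * M / q) * (c * SC)"
    unfolding l SC by simp
  finally have 2: "(1 - M) * (1 - M * l / q) / (1 - D * M / q) * (Um - U) = c * SC"
    using denC by (rule quotient)
  have "(1 - 1 / (Y * M * A)) * (A * M * ((1 - 1 / (M * q * B)) * (1 - D) / (1 - 1 / (q * (D * M))))) * (Up - U)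
     + (1 - D / (A * Y)) * (A * ((1 - M) * (1 - M * l / q) / (1 - D * M / q))) * (Um - U)
     = (1 - 1 / (Y * M * A)) * A * M * ((1 - 1 / (M * q * B)) * (1 - D) / (1 - 1 / (q * (D * M))) * (Up - U))
     + (1 - D / (A * Y)) * A * ((1 - M) * (1 - M * l / q) / (1 - D * M / q) * (Um - U))"
    by (simp only: mult.assoc)
  \<comment> \<open>The factors \<open>A * M\<close> and \<open>A\<close> of the two coefficients
    clear all of their denominators except a common \<open>1 / Y\<close>.\<close>
  also have "\<dots> = c / Y * ((A * M * Y - 1) * SA + (A * Y - D) * SC)"
    unfolding 1 2 using nz by (simp add: field_simps)
  also have "\<dots> = c / Y * (Y * (1 - A) * (1 - D * M) * S)"
    using tel by simp
  also have "\<dots> = (1 - A) * (1 - D * M) * U"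
    using nz by (simp add: U)
  finally show ?thesis .
qed

section \<open>The sums for the q-Hahn functions\<close>

text \<open>The summand is split into a weight independent of \<open>m\<close> and a product
  carrying all of the dependence on \<open>m\<close>, so that neighbouring indices can be combined
  term by term.\<close>

lemma qHahnU_eq:
  assumes "q > 0"
  shows "qHahnU m (real n) a b N q =
    (q ^ N / (q ^ m * q powr b)) ^ m * (qpoch (1 / q ^ N) q m / qpoch (1 / (q ^ m * q powr b)) q m)
    * (\<Sum>k\<le>m. q ^ k * qpoch (1 / q ^ n) q k
          / (qpoch (1 / q ^ N) q k * qpoch q q k * qpoch (q powr a * (1 / q ^ n)) q k)
        * (qpoch (1 / q ^ m) q k * qpoch (q powr b * q ^ m * (1 / q ^ N)) q k))"
proof -
  have "q powr (real m * (real N - real m - b)) = (q powr (real N - real m - b)) ^ m"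
    using assms by (simp add: powr_powr powr_realpow[symmetric] mult.commute)
  also have "q powr (real N - real m - b) = q ^ N / (q ^ m * q powr b)"
    using assms by (simp add: powr_diff powr_realpow)
  finally have 1: "q powr (real m * (real N - real m - b)) = (q ^ N / (q ^ m * q powr b)) ^ m" .
  have 2: "q powr (- real j) = 1 / q ^ j" for j
    using assms by (simp add: powr_minus powr_realpow inverse_eq_divide)
  have 3: "q powr (- real m - b) = 1 / (q ^ m * q powr b)"
    using assms by (simp add: powr_diff 2)
  have 4: "q powr (b + real m - real N) = q powr b * q ^ m * (1 / q ^ N)"
    "q powr (a - real n) = q powr a * (1 / q ^ n)"
    using assms by (simp_all add: powr_diff powr_add powr_realpow)
  show ?thesis
    unfolding qHahnU_def 1 2 3 4 by (simp add: mult_ac)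
qed

theorem proposition7p4:
  fixes q a b :: real and N :: nat
  assumes q_pos: "q > 0" and q_ne_1: "q \<noteq> 1"
    and N_pos: "N \<ge> 1"
    and den_prefactor: "\<And>m. m \<le> N \<Longrightarrow> qpoch (q powr (- real m - b)) q m \<noteq> 0"
    and den_sum: "\<And>m n k. \<lbrakk>m \<le> N; n \<le> N; k \<le> m\<rbrakk> \<Longrightarrow>
        qpoch (q powr (- real N)) q k * qpoch (q powr (a - real n)) q k \<noteq> 0 \<and> qpoch q q k \<noteq> 0"
    and den_A: "\<And>m. m \<le> N \<Longrightarrow> qnum q (real N - 2 * real m - b - 1) \<noteq> 0"
    and den_C: "\<And>m. m \<le> N \<Longrightarrow> qnum q (2 * real m + b - real N - 1) \<noteq> 0"
  shows "\<forall>m\<le>N. \<forall>n\<le>N.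
     qnum q (real n - real m - a) * coeffA m a b N q
        * (qHahnU (m + 1) (real n) a b N q - qHahnU m (real n) a b N q)
     + qnum q (real n + real m - a + b - real N) * coeffC m a b N q
        * (qHahnU (m - 1) (real n) a b N q - qHahnU m (real n) a b N q)
     = qnum q a * qnum q (2 * real m + b - real N) * qHahnU m (real n) a b N q"

proof (intro allI impI)
  fix m n assume m: "m \<le> N" and n: "n \<le> N"
  define A B M l Y where "A = q powr a" and "B = q powr b" and "M = q ^ m"
    and "l = 1 / q ^ N" and "Y = 1 / q ^ n"
  define D where "D = B * M * l"
  have nz: "q \<noteq> 0" "A \<noteq> 0" "B \<noteq> 0" "M \<noteq> 0" "l \<noteq> 0" "Y \<noteq> 0"
    using q_pos by (simp_all add: A_def B_def M_def l_def Y_def)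
  \<comment> \<open>A common range for all three sums. At \<open>m = N\<close> it must stop at
    \<open>N\<close>, since \<open>(l)_(N+1) = 0\<close> is a denominator; nothing is lost because
    \<open>U_(N+1)\<close> vanishes by its prefactor.\<close>
  define R where "R = (if m < N then Suc m else N)"
  have R: "R \<le> N" "m \<le> R" using m by (auto simp: R_def)
  define V where "V k = q ^ k * qpoch Y q k / (qpoch l q k * qpoch q q k * qpoch (A * Y) q k)" for k
  define S where "S i E = (\<Sum>k\<le>R. V k * (qpoch (1 / i) q k * qpoch E q k))" for i E
  define SA where "SA = (\<Sum>k\<le>R. V k * raise_term q M D l k)"
  define SC where "SC = (\<Sum>k\<le>R. V k * lower_term q M D l k)"
  define c where "c j = (q ^ N / (q ^ j * B)) ^ j * (qpoch l q j / qpoch (1 / (q ^ j * B)) q j)" for j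
  have pw: "q powr real j = q ^ j" for j using q_pos by (simp add: powr_realpow)

  have U: "qHahnU j (real n) a b N q = c j * S (q ^ j) (B * q ^ j * l)" if "j \<le> R" for j
  proof -
    have "qHahnU j (real n) a b N q = c j * (\<Sum>k\<le>j. V k * (qpoch (1 / q ^ j) q k * qpoch (B * q ^ j * l) q k))"
      unfolding qHahnU_eq[OF q_pos] by (simp add: c_def V_def A_def B_def l_def Y_def)
    \<comment> \<open>The added terms vanish, because \<open>(q^(-j))_k = 0\<close> for
      \<open>k > j\<close>.\<close>
    also have "(\<Sum>k\<le>j. V k * (qpoch (1 / q ^ j) q k * qpoch (B * q ^ j * l) q k)) = S (q ^ j) (B * q ^ j * l)"
      unfolding S_def using that q_pos
      by (intro sum.mono_neutral_left) (auto simp: qpoch_inverse_power_eq_0)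
    finally show ?thesis .
  qed

  have SA: "(1 - M * l) * ((1 - D) * S (M * q) (D * q)) - (q * (D * M) - M * l) * (1 - D) * S M D
      = (q * (D * M) - 1) * SA"
    unfolding S_def SA_def sum_distrib_left sum_subtractf[symmetric]
  proof (intro sum.cong refl)
    fix k
    have aux: "x * (y * (v * w)) - z * y * (v * s) = t * (v * r)"
      if "x * (y * w) - z * y * s = t * r" for x y z v w s t r :: real
      using that by algebra
    show "(1 - M * l) * ((1 - D) * (V k * (qpoch (1 / (M * q)) q k * qpoch (D * q) q k)))
        - (q * (D * M) - M * l) * (1 - D) * (V k * (qpoch (1 / M) q k * qpoch D q k))
      = (q * (D * M) - 1) * (V k * raise_term q M D l k)"
      by (rule aux) (rule raise_combination[OF nz(1,4)])
  qed
  have SC: "(1 - M) * ((D * M - M * l) / q * S (M / q) (D / q) - (1 - M * l / q) * S M D)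
      = (1 - D * M / q) * SC"
    unfolding S_def SC_def sum_distrib_left sum_subtractf[symmetric]
  proof (intro sum.cong refl)
    fix k
    have aux: "x * (y * (v * w) - z * (v * s)) = t * (v * r)"
      if "x * (y * w - z * s) = t * r" for x y z v w s t r :: real
      using that by algebra
    have "qpoch (1 / (M / q)) q k = qpoch (q / M) q k" by simp
    then show "(1 - M) * ((D * M - M * l) / q * (V k * (qpoch (1 / (M / q)) q k * qpoch (D / q) q k))
        - (1 - M * l / q) * (V k * (qpoch (1 / M) q k * qpoch D q k)))
      = (1 - D * M / q) * (V k * lower_term q M D l k)"
      using aux[OF lower_combination[OF nz(1,4), of D l k]] by metis
  qed

  \<comment> \<open>Using \<open>den_sum\<close> at the top index \<open>N\<close> rather than at
    \<open>m\<close> reaches \<open>k = R\<close>, which may be \<open>m + 1\<close>.\<close>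
  have "qpoch l q R \<noteq> 0" "qpoch (A * Y) q R \<noteq> 0" "qpoch q q R \<noteq> 0"
    using den_sum[OF order_refl n R(1)] q_pos
    by (simp_all add: l_def A_def Y_def powr_minus powr_diff pw inverse_eq_divide)
  note telescoped_sum[OF nz(1,4) this, of D, folded V_def]
  moreover have "(A * M * Y - 1) * SA + (A * Y - D) * SC - Y * (1 - A) * (1 - D * M) * S M D
    = (\<Sum>k\<le>R. V k * ((A * M * Y - 1) * raise_term q M D l k + (A * Y - D) * lower_term q M D l k
         - Y * (1 - A) * (1 - D * M) * (qpoch (1 / M) q k * qpoch D q k)))"
    unfolding S_def SA_def SC_def sum_distrib_left sum_subtractf[symmetric] sum.distrib[symmetric]
    by (intro sum.cong refl) algebra
  moreover have "qpoch (1 / M) q R = 0 \<or> qpoch Y q (Suc R) = 0"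
    using qpoch_inverse_power_eq_0[OF q_pos] n by (auto simp: R_def M_def Y_def)
  ultimately have tel: "(A * M * Y - 1) * SA + (A * Y - D) * SC - Y * (1 - A) * (1 - D * M) * S M D = 0"
    by auto

  have Up: "(1 - 1 / (M * q * B)) * qHahnU (Suc m) (real n) a b N q
      = c m / (q * (D * M)) * (1 - M * l) * S (M * q) (D * q)"
  proof (cases "m < N")
    case True
    define w where "w = 1 - 1 / (M * q * B)"
    have "qpoch (1 / (M * q * B)) q (Suc m) \<noteq> 0"
      using den_prefactor[of "Suc m"] True q_pos
      by (simp add: powr_diff powr_minus powr_add pw M_def B_def inverse_eq_divide mult_ac)
    \<comment> \<open>The denominators of the two prefactors differ by the first factor
      \<open>w\<close> alone.\<close>
    moreover have sh: "qpoch (1 / (M * q * B)) q (Suc m) = w * qpoch (1 / (M * B)) q m"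
      using qpoch_shift[of "1 / (M * q * B)" q m] nz by (simp add: w_def)
    ultimately have w: "w \<noteq> 0" by auto
    have "c (Suc m) = (q ^ N / (q * M * B)) ^ Suc m
        * (qpoch l q m * (1 - M * l) / (w * qpoch (1 / (M * B)) q m))"
      using sh by (simp add: c_def qpoch_Suc M_def mult_ac)
    \<comment> \<open>The extra \<open>q\<close> in the base contributes \<open>1 / M\<close>, and
      the extra power contributes \<open>1 / (q * M * B * l)\<close>.\<close>
    also have "(q ^ N / (q * M * B)) ^ Suc m = (q ^ N / (M * B)) ^ m * (1 / (q * (D * M)))"
    proof -
      have "(q ^ N / (q * M * B)) ^ Suc m = (q ^ N / (M * B)) ^ m / q ^ m * (q ^ N / (q * M * B))"
        by (simp add: power_divide power_mult_distrib mult_ac)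
      also have "\<dots> = (q ^ N / (M * B)) ^ m * (1 / (q * (D * M)))"
        using q_pos by (simp add: D_def l_def M_def)
      finally show ?thesis .
    qed
    finally have "w * c (Suc m) = c m / (q * (D * M)) * (1 - M * l)"
      using w by (simp add: c_def M_def mult_ac)
    moreover have "qHahnU (Suc m) (real n) a b N q = c (Suc m) * S (M * q) (D * q)"
      using U[of "Suc m"] True by (simp add: R_def M_def D_def mult_ac)
    ultimately show ?thesis by (simp only: w_def mult.assoc[symmetric])
  next
    case False
    then have "m = N" using m by simp
    \<comment> \<open>Both sides are zero: on the right \<open>M * l = 1\<close>.\<close>
    then show ?thesis using qHahnU_Suc_N[OF q_pos] q_pos by (simp add: M_def l_def)
  qed

  have Um: "(1 - M) * ((1 - M * l / q) * qHahnU (m - 1) (real n) a b N q)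
      = (1 - M) * (c m * (D * M / q) * (1 - 1 / (M * B)) * S (M / q) (D / q))"
  proof (cases m)
    case 0
    \<comment> \<open>Here \<open>M = 1\<close>, so the value at the truncated index
      \<open>m - 1\<close> is irrelevant.\<close>
    then show ?thesis by (simp add: M_def)
  next
    case (Suc j)
    define w where "w = 1 - 1 / (M * B)"
    have M: "M = q * q ^ j" by (simp add: M_def Suc)
    have sh: "qpoch (1 / (M * B)) q m = w * qpoch (1 / (q ^ j * B)) q j"
      using qpoch_shift[of "1 / (M * B)" q j] nz by (simp add: w_def Suc M)
    have "qpoch (1 / (M * B)) q m \<noteq> 0"
      using den_prefactor[OF m] q_pos by (simp add: powr_diff powr_minus pw M_def B_def field_simps)
    then have w: "w \<noteq> 0" using sh by auto
    have "c m * (D * M / q) * w = (q ^ N / (M * B)) ^ m * (D * M / q)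
        * (qpoch l q j * (1 - M * l / q) / qpoch (1 / (q ^ j * B)) q j)"
      unfolding c_def M_def[symmetric] sh using w nz by (simp add: Suc qpoch_Suc M mult_ac)
    also have "(q ^ N / (M * B)) ^ m * (D * M / q) = (q ^ N / (q ^ j * B)) ^ j"
    proof -
      have "(q ^ N / (M * B)) ^ m = (q ^ N / (q ^ j * B)) ^ j / q ^ j * (q ^ N / (M * B))"
        by (simp add: Suc M power_divide power_mult_distrib mult_ac)
      then show ?thesis using q_pos nz by (simp add: D_def l_def M)
    qed
    finally have "c m * (D * M / q) * w = (1 - M * l / q) * c j"
      by (simp add: c_def)
    moreover have "qHahnU (m - 1) (real n) a b N q = c j * S (M / q) (D / q)"
      using U[of j] R Suc q_pos by (simp add: M D_def mult_ac)
    ultimately have "(1 - M * l / q) * qHahnU (m - 1) (real n) a b N q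
        = c m * (D * M / q) * (1 - 1 / (M * B)) * S (M / q) (D / q)"
      by (simp only: w_def mult.assoc[symmetric])
    then show ?thesis by (simp only:)
  qed

  have two_m: "q powr (2 * real m) = M * M"
    by (simp only: mult_2 powr_add pw M_def)
  have "q powr (real N - 2 * real m - b - 1) = 1 / (q * (D * M))"
    "q powr (2 * real m + b - real N - 1) = D * M / q"
    "q powr (2 * real m + b - real N) = D * M"
    using q_pos by (simp_all add: powr_diff powr_add pw two_m D_def M_def B_def l_def)
  note pws = this
  have dens: "1 - 1 / (q * (D * M)) \<noteq> 0" "1 - D * M / q \<noteq> 0"
    using den_A[OF m] den_C[OF m] by (auto simp: qnum_def pws)
  have coeffA_eq: "qnum q (real n - real m - a) * coeffA m a b N q
      = (1 - 1 / (Y * M * A)) * (A * M * ((1 - 1 / (M * q * B)) * (1 - D) / (1 - 1 / (q * (D * M))))) / (1 - q)\<^sup>2"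
  proof -
    have "q powr (real n - real m - a) = 1 / (Y * M * A)" "q powr (a + real m) = A * M"
      "q powr (- real m - b - 1) = 1 / (M * q * B)" "q powr (real m + b - real N) = D"
      using q_pos by (simp_all add: powr_diff powr_add powr_minus pw A_def B_def M_def Y_def D_def l_def field_simps)
    then show ?thesis
      using q_ne_1 by (simp add: qnum_def coeffA_def pws power2_eq_square)
  qed
  have coeffC_eq: "qnum q (real n + real m - a + b - real N) * coeffC m a b N q
      = (1 - D / (A * Y)) * (A * ((1 - M) * (1 - M * l / q) / (1 - D * M / q))) / (1 - q)\<^sup>2"
  proof -
    have "q powr (real n + real m - a + b - real N) = D / (A * Y)"
      "q powr (real m - real N - 1) = M * l / q"
      using q_pos by (simp_all add: powr_diff powr_add pw A_def B_def M_def Y_def D_def l_def field_simps)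
    then show ?thesis
      using q_ne_1 by (simp add: qnum_def coeffC_def pws pw M_def A_def power2_eq_square)
  qed
  have rhs: "qnum q a * qnum q (2 * real m + b - real N) = (1 - A) * (1 - D * M) / (1 - q)\<^sup>2"
    by (simp add: qnum_def pws A_def power2_eq_square)
  have "qHahnU m (real n) a b N q = c m * S M D"
    using U[OF R(2)] by (simp add: M_def D_def)
  note rec = recurrence_from_sums[OF nz D_def dens SA SC tel this Up Um]
  \<comment> \<open>Each of the three coefficients has two more q-numbers above than below the
    fraction bar, hence the common divisor \<open>(1 - q)^2\<close>.\<close>
  have scale: "f / k * x + g / k * y = h / k * u" if "f * x + g * y = h * u" for f g h k x y u :: real
    using that by (simp add: add_divide_distrib[symmetric])
  show "qnum q (real n - real m - a) * coeffA m a b N q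
        * (qHahnU (m + 1) (real n) a b N q - qHahnU m (real n) a b N q)
     + qnum q (real n + real m - a + b - real N) * coeffC m a b N q
        * (qHahnU (m - 1) (real n) a b N q - qHahnU m (real n) a b N q)
     = qnum q a * qnum q (2 * real m + b - real N) * qHahnU m (real n) a b N q"
    unfolding coeffA_eq coeffC_eq rhs Suc_eq_plus1[symmetric] by (rule scale[OF rec])
qed

end
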